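(* Let $F\subset\mathbb{R}^n$ be a nonempty compact convex set with $0\in\operatorname{int}(F)$ and Minkowski gauge $\rho_F$. Let $A=\{a^1,\ldots,a^m\}\subset\mathbb{R}^n$ be a set of $m$ pairwise distinct demand points, with $m\ge 2$, and let $k$ be an integer with $1\le k\le m$. Consider the generalized multi-source Weber problem of minimizing $$f_F(x)=\sum_{i=1}^m\Big(\min_{\ell=1,\ldots,k}\rho_F(x^\ell-a^i)\Big)$$ over all $x=(x^1,\ldots,x^k)\in(\mathbb{R}^n)^k=\mathbb{R}^{nk}$. Then the set $S_F$ of all global optimal solutions (global minimizers of $f_F$ over $\mathbb{R}^{nk}$) is compact.
   Context: For a nonempty compact convex set $F\subset\mathbb{R}^n$ with $0\in\operatorname{int}(F)$, the Minkowski function (gauge) is $\rho_F(x)=\inf\{t\ge 0\mid x\in tF\}$, $x\in\mathbb{R}^n$. Note that $F$ is not assumed symmetric. *)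

theory Defs
  imports "HOL-Analysis.Analysis"
begin

definition minkowski_gauge :: "(real ^ 'n) set \<Rightarrow> real ^ 'n \<Rightarrow> real" where
  "minkowski_gauge F x = Inf {t. 0 \<le> t \<and> x \<in> (\<lambda>y. t *\<^sub>R y) ` F}"

text \<open>
  The decision variable is a vector of \<open>k = CARD('k)\<close> centres in \<open>real ^ 'n\<close>, so that
  \<open>real ^ 'n ^ 'k\<close> carries the Euclidean topology of the \<open>nk\<close>-dimensional space. Only the
  values \<open>a 1, \<dots>, a m\<close> of the demand point sequence are used.
\<close>

definition weber_objective ::
    "(real ^ 'n) set \<Rightarrow> nat \<Rightarrow> (nat \<Rightarrow> real ^ 'n) \<Rightarrow> real ^ 'n ^ 'k \<Rightarrow> real" where
  "weber_objective F m a x =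
     (\<Sum>i = 1..m. MIN l \<in> UNIV. minkowski_gauge F (x $ l - a i))"

definition weber_solutions ::
    "(real ^ 'n) set \<Rightarrow> nat \<Rightarrow> (nat \<Rightarrow> real ^ 'n) \<Rightarrow> (real ^ 'n ^ 'k) set" where
  "weber_solutions F m a = {x. \<forall>y :: real ^ 'n ^ 'k. weber_objective F m a x \<le> weber_objective F m a y}"

end

theory Submission
  imports Defs
begin

text \<open>
  The objective is continuous because the gauge is Lipschitz, so the solution set is closed. For
  boundedness, a centre of an optimal solution must be a nearest centre of some demand point:
  the other centres number at most \<open>m - 1\<close> and hence miss some demand point, and moving a
  centre that serves nobody onto the missed point would strictly decrease the objective. So every
  centre lies within the optimal value of a demand point, measured in the gauge.
\<close>

section \<open>The Minkowski gauge\<close>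

lemma minkowski_gauge_le:
  assumes "0 \<le> t" "y \<in> F"
  shows "minkowski_gauge F (t *\<^sub>R y) \<le> t"
  unfolding minkowski_gauge_def
  by (rule cInf_lower) (use assms in \<open>auto intro!: bdd_belowI[of _ 0]\<close>)

text \<open>For nonzero \<open>x\<close>, rescaling to length \<open>r\<close> lands in the ball,
  hence in \<open>F\<close>. This makes the set under the infimum nonempty for every
  \<open>x\<close>, without which \<open>Inf\<close> would say nothing useful.\<close>

lemma minkowski_gauge_witness:
  assumes "cball 0 r \<subseteq> F" "r > 0"
  shows "\<exists>y\<in>F. x = (norm x / r) *\<^sub>R y"
proof (cases "x = 0")
  case True
  moreover have "0 \<in> F" using assms by (auto simp: subset_iff)
  ultimately show ?thesis by auto
next
  case False
  then have "(r / norm x) *\<^sub>R x \<in> F" using assms by (auto simp: subset_iff)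
  moreover have "x = (norm x / r) *\<^sub>R ((r / norm x) *\<^sub>R x)" using False assms by simp
  ultimately show ?thesis by blast
qed

text \<open>The introduction rule for lower bounds on the gauge: a bound valid for every
  representation \<open>x = t *\<^sub>R y\<close> passes to the infimum. The ball supplies the
  nonemptiness.\<close>

lemma minkowski_gauge_ge:
  assumes "cball 0 r \<subseteq> F" "r > 0"
    and "\<And>t y. 0 \<le> t \<Longrightarrow> y \<in> F \<Longrightarrow> x = t *\<^sub>R y \<Longrightarrow> c \<le> t"
  shows "c \<le> minkowski_gauge F x"
proof -
  obtain y where "y \<in> F" "x = (norm x / r) *\<^sub>R y"
    using minkowski_gauge_witness[OF assms(1,2)] by blast
  then have "norm x / r \<in> {t. 0 \<le> t \<and> x \<in> (\<lambda>y. t *\<^sub>R y) ` F}"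
    using assms(2) by auto
  then show ?thesis
    unfolding minkowski_gauge_def using assms(3) by (intro cInf_greatest) auto
qed

lemma minkowski_gauge_le_norm:
  assumes "cball 0 r \<subseteq> F" "r > 0"
  shows "minkowski_gauge F x \<le> norm x / r"
proof -
  obtain y where y: "y \<in> F" "x = (norm x / r) *\<^sub>R y"
    using minkowski_gauge_witness[OF assms] by blast
  have "minkowski_gauge F ((norm x / r) *\<^sub>R y) \<le> norm x / r"
    using y(1) assms(2) by (intro minkowski_gauge_le) auto
  then show ?thesis using y(2) by simp
qed

text \<open>If \<open>x = t *\<^sub>R y\<close> with \<open>norm y \<le> B\<close>, then
  \<open>norm x \<le> t * B\<close>. This later gives both positivity of the gauge off the origin
  and boundedness of the solutions.\<close>

lemma minkowski_gauge_ge_norm: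
  assumes "cball 0 r \<subseteq> F" "r > 0" "F \<subseteq> cball 0 B" "B > 0"
  shows "norm x \<le> B * minkowski_gauge F x"
proof -
  have "norm x / B \<le> minkowski_gauge F x"
  proof (rule minkowski_gauge_ge[OF assms(1,2)])
    fix t y assume t: "0 \<le> t" "y \<in> F" "x = t *\<^sub>R y"
    then have "norm y \<le> B" using assms(3) by (auto simp: subset_iff)
    then show "norm x / B \<le> t"
      using t assms(4) by (simp add: divide_le_eq mult_left_mono)
  qed
  then show ?thesis using assms(4) by (simp add: field_simps)
qed

lemma minkowski_gauge_nonneg:
  assumes "cball 0 r \<subseteq> F" "r > 0"
  shows "0 \<le> minkowski_gauge F x"
  by (rule minkowski_gauge_ge[OF assms])

lemma minkowski_gauge_zero:
  assumes "cball 0 r \<subseteq> F" "r > 0"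
  shows "minkowski_gauge F 0 = 0"
  using minkowski_gauge_le_norm[OF assms, of 0] minkowski_gauge_nonneg[OF assms, of 0] by simp

lemma minkowski_gauge_triangle:
  assumes "cball 0 r \<subseteq> F" "r > 0" "convex F"
  shows "minkowski_gauge F (x + y) \<le> minkowski_gauge F x + minkowski_gauge F y"
proof -
  have sum: "minkowski_gauge F (s *\<^sub>R u + t *\<^sub>R v) \<le> s + t"
    if "0 \<le> s" "0 \<le> t" "u \<in> F" "v \<in> F" for s t u v
  proof (cases "s + t = 0")
    case True
    then show ?thesis using that minkowski_gauge_zero[OF assms(1,2)] by (simp add: add_nonneg_eq_0_iff)
  next
    case False
    \<comment> \<open>Normalising the weights gives a convex combination \<open>?w\<close> in
      \<open>F\<close> with
      \<open>(s + t) *\<^sub>R ?w = s *\<^sub>R u + t *\<^sub>R v\<close>.\<close>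
    let ?w = "(s / (s + t)) *\<^sub>R u + (t / (s + t)) *\<^sub>R v"
    have "?w \<in> F"
      using that False assms(3) by (intro convexD) (auto simp: add_divide_distrib[symmetric])
    then have "minkowski_gauge F ((s + t) *\<^sub>R ?w) \<le> s + t"
      using that by (intro minkowski_gauge_le) auto
    then show ?thesis using False by (simp add: scaleR_add_right)
  qed
  \<comment> \<open>The two infima are taken one after the other: subtracting leaves a single gauge
    on the right, to which the lower bound rule applies.\<close>
  have "minkowski_gauge F (x + y) - minkowski_gauge F y \<le> minkowski_gauge F x"
  proof (rule minkowski_gauge_ge[OF assms(1,2)])
    fix s u assume s: "0 \<le> s" "u \<in> F" "x = s *\<^sub>R u"
    have "minkowski_gauge F (x + y) - s \<le> minkowski_gauge F y"
    proof (rule minkowski_gauge_ge[OF assms(1,2)])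
      fix t v assume "0 \<le> t" "v \<in> F" "y = t *\<^sub>R v"
      then show "minkowski_gauge F (x + y) - s \<le> t"
        using sum[of s t u v] s by simp
    qed
    then show "minkowski_gauge F (x + y) - minkowski_gauge F y \<le> s" by simp
  qed
  then show ?thesis by simp
qed

lemma continuous_on_minkowski_gauge:
  assumes "cball 0 r \<subseteq> F" "r > 0" "convex F"
  shows "continuous_on UNIV (minkowski_gauge F)"
proof -
  have *: "minkowski_gauge F x - minkowski_gauge F y \<le> norm (x - y) / r" for x y
    using minkowski_gauge_triangle[OF assms, of "x - y" y]
      minkowski_gauge_le_norm[OF assms(1,2), of "x - y"] by simp
  \<comment> \<open>The gauge may be asymmetric, but the bound \<open>norm (x - y) / r\<close> is
    symmetric, so using it in both orders controls the absolute value.\<close>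
  have "dist (minkowski_gauge F x) (minkowski_gauge F y) \<le> (1 / r) * dist x y" for x y
    using *[of x y] *[of y x] by (simp add: dist_norm norm_minus_commute abs_le_iff)
  then have "(1 / r)-lipschitz_on UNIV (minkowski_gauge F)"
    using assms(2) by (intro lipschitz_onI) auto
  then show ?thesis by (rule lipschitz_on_continuous_on)
qed

lemma continuous_on_Min:
  fixes g :: "'i \<Rightarrow> 'a::topological_space \<Rightarrow> 'b::linorder_topology"
  assumes "finite I" "I \<noteq> {}" "\<And>i. i \<in> I \<Longrightarrow> continuous_on S (g i)"
  shows "continuous_on S (\<lambda>x. MIN i\<in>I. g i x)"
  using assms
proof (induction rule: finite_ne_induct)
  case (insert i I)
  then show ?case by (simp add: continuous_on_min)
qed simp

section \<open>The multi-source Weber problem\<close>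

lemma continuous_on_weber_objective:
  fixes F :: "(real ^ 'n) set"
  assumes "cball 0 r \<subseteq> F" "r > 0" "convex F"
  shows "continuous_on UNIV (weber_objective F m a :: real ^ 'n ^ 'k::finite \<Rightarrow> real)"
  unfolding weber_objective_def[abs_def]
  by (intro continuous_on_sum continuous_on_Min continuous_intros
      continuous_on_compose2[OF continuous_on_minkowski_gauge[OF assms]]) auto

lemma weber_solutions_nearest:
  fixes F :: "(real ^ 'n) set" and x :: "real ^ 'n ^ 'k::finite"
  assumes r: "cball 0 r \<subseteq> F" "r > 0" and "bounded F"
    and inj: "inj_on a {1..m}" and card: "CARD('k) \<le> m"
    and x: "x \<in> weber_solutions F m a"
  shows "\<exists>i\<in>{1..m}. minkowski_gauge F (x $ l - a i) = (MIN j\<in>UNIV. minkowski_gauge F (x $ j - a i))"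
proof (rule ccontr)
  let ?\<rho> = "minkowski_gauge F"
  let ?d = "\<lambda>(x :: real ^ 'n ^ 'k) i. MIN j\<in>UNIV. ?\<rho> (x $ j - a i)"
  assume "\<not> ?thesis"
  then have far: "?\<rho> (x $ l - a i) \<noteq> ?d x i" if "i \<in> {1..m}" for i
    using that by blast
  have nearest: "\<exists>j. j \<noteq> l \<and> ?d x i = ?\<rho> (x $ j - a i)" if "i \<in> {1..m}" for i
  proof -
    have "?d x i \<in> range (\<lambda>j. ?\<rho> (x $ j - a i))"
      by (rule Min_in) auto
    then obtain j where j: "?d x i = ?\<rho> (x $ j - a i)" by blast
    with far[OF that] have "j \<noteq> l" by metis
    with j show ?thesis by blast
  qed
  \<comment> \<open>The centres other than \<open>l\<close> take at most \<open>CARD('k) - 1\<close>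
    values, fewer than the \<open>m\<close> distinct demand points.\<close>
  have "card ((\<lambda>j. x $ j) ` (UNIV - {l})) \<le> card (UNIV - {l})"
    by (rule card_image_le) simp
  also have "\<dots> < CARD('k)"
    by (rule psubset_card_mono) auto
  also have "\<dots> \<le> card (a ` {1..m})"
    using card inj by (simp add: card_image)
  finally have "\<not> a ` {1..m} \<subseteq> (\<lambda>j. x $ j) ` (UNIV - {l})"
    using card_mono[of "(\<lambda>j. x $ j) ` (UNIV - {l})" "a ` {1..m}"] by auto
  then obtain p where p: "p \<in> {1..m}" and missed: "a p \<notin> (\<lambda>j. x $ j) ` (UNIV - {l})"
    by blast
  define y :: "real ^ 'n ^ 'k" where "y = (\<chi> j. if j = l then a p else x $ j)"
  \<comment> \<open>Each minimum for \<open>x\<close> is attained at some centre other than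
    \<open>l\<close>, and \<open>y\<close> keeps that centre.\<close>
  have "?d y i \<le> ?d x i" if "i \<in> {1..m}" for i
  proof -
    obtain j where j: "j \<noteq> l" "?d x i = ?\<rho> (x $ j - a i)" using nearest[OF \<open>i \<in> {1..m}\<close>] by blast
    have "?d y i \<le> ?\<rho> (y $ j - a i)" by (rule Min_le) auto
    then show ?thesis using j by (simp add: y_def)
  qed
  \<comment> \<open>The centre of \<open>x\<close> nearest to \<open>a p\<close> differs from
    \<open>a p\<close>, so its gauge distance is positive, while centre \<open>l\<close> of
    \<open>y\<close> lies on \<open>a p\<close> and costs zero.\<close>
  moreover have "?d y p < ?d x p"
  proof -
    obtain j where j: "j \<noteq> l" "?d x p = ?\<rho> (x $ j - a p)" using nearest[OF p] by blast
    obtain B where "B > 0" "F \<subseteq> cball 0 B"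
      using \<open>bounded F\<close> by (auto simp: bounded_pos subset_iff)
    then have "norm (x $ j - a p) \<le> B * ?\<rho> (x $ j - a p)"
      using minkowski_gauge_ge_norm[OF r] by blast
    moreover have "norm (x $ j - a p) > 0" using missed j(1) by force
    ultimately have "0 < B * ?\<rho> (x $ j - a p)" by linarith
    then have "0 < ?\<rho> (x $ j - a p)" using \<open>B > 0\<close> by (simp add: zero_less_mult_iff)
    moreover have "?d y p \<le> ?\<rho> (y $ l - a p)" by (rule Min_le) auto
    then have "?d y p \<le> 0" using minkowski_gauge_zero[OF r] by (simp add: y_def)
    ultimately show ?thesis using j(2) by linarith
  qed
  ultimately have "weber_objective F m a y < weber_objective F m a x"
    unfolding weber_objective_def using p by (intro sum_strict_mono_ex1) auto
  then show False
    using x by (auto simp: weber_solutions_def not_le[symmetric])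
qed

lemma bounded_weber_solutions:
  fixes F :: "(real ^ 'n) set"
  assumes r: "cball 0 r \<subseteq> F" "r > 0" and "bounded F"
    and "inj_on a {1..m}" "CARD('k::finite) \<le> m"
  shows "bounded (weber_solutions F m a :: (real ^ 'n ^ 'k) set)"
proof -
  let ?\<rho> = "minkowski_gauge F"
  let ?f = "weber_objective F m a :: real ^ 'n ^ 'k \<Rightarrow> real"
  obtain B where B: "B > 0" "F \<subseteq> cball 0 B"
    using \<open>bounded F\<close> by (auto simp: bounded_pos subset_iff)
  \<comment> \<open>The origin is just a comparison configuration: its cost bounds the optimal
    value, and \<open>B\<close> converts this to the Euclidean norm. Summing all
    \<open>norm (a i)\<close> makes \<open>C\<close> independent of which demand point a centre
    serves.\<close>
  define C where "C = B * ?f 0 + (\<Sum>i = 1..m. norm (a i))"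
  have comp: "norm (x $ l) \<le> C" if x: "x \<in> weber_solutions F m a" for x :: "real ^ 'n ^ 'k" and l
  proof -
    obtain i where i: "i \<in> {1..m}" "?\<rho> (x $ l - a i) = (MIN j\<in>UNIV. ?\<rho> (x $ j - a i))"
      using weber_solutions_nearest[OF assms x] by blast
    have "(MIN j\<in>UNIV. ?\<rho> (x $ j - a i)) \<le> ?f x"
      unfolding weber_objective_def using i(1)
      by (intro member_le_sum) (auto simp: minkowski_gauge_nonneg[OF r])
    also have "\<dots> \<le> ?f 0" using x by (simp add: weber_solutions_def)
    finally have "B * ?\<rho> (x $ l - a i) \<le> B * ?f 0" using B(1) i(2) by simp
    then have "norm (x $ l - a i) \<le> B * ?f 0"
      using minkowski_gauge_ge_norm[OF r B(2,1), of "x $ l - a i"] by linarith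
    moreover have "norm (a i) \<le> (\<Sum>i = 1..m. norm (a i))"
      using i(1) by (intro member_le_sum) auto
    moreover have "norm (x $ l) \<le> norm (x $ l - a i) + norm (a i)"
      using norm_triangle_ineq[of "x $ l - a i" "a i"] by simp
    ultimately show ?thesis unfolding C_def by linarith
  qed
  have "norm x \<le> real CARD('k) * C" if "x \<in> weber_solutions F m a" for x :: "real ^ 'n ^ 'k"
  proof -
    have "norm x \<le> (\<Sum>l\<in>UNIV. norm (x $ l))"
      unfolding norm_vec_def by (rule L2_set_le_sum) simp
    also have "\<dots> \<le> real CARD('k) * C"
      using sum_bounded_above[of UNIV "\<lambda>l. norm (x $ l)" C] comp[OF that] by simp
    finally show ?thesis .
  qed
  then show ?thesis by (auto simp: bounded_iff)
qed

text \<open>The solution set is the intersection over all \<open>y\<close> of the closed sublevel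
  sets of the objective at level \<open>weber_objective F m a y\<close>.\<close>

lemma closed_weber_solutions:
  fixes F :: "(real ^ 'n) set"
  assumes "cball 0 r \<subseteq> F" "r > 0" "convex F"
  shows "closed (weber_solutions F m a :: (real ^ 'n ^ 'k::finite) set)"
  unfolding weber_solutions_def
  by (intro closed_Collect_all closed_Collect_le continuous_on_const
      continuous_on_weber_objective[OF assms])

theorem theorem3p4:
  fixes F :: "(real ^ 'n) set" and a :: "nat \<Rightarrow> real ^ 'n" and m :: nat
  assumes "F \<noteq> {}" and "compact F" and "convex F" and "0 \<in> interior F"
    and "m \<ge> 2" and "inj_on a {1..m}"
    and "1 \<le> CARD('k::finite)" and "CARD('k) \<le> m"
  shows "compact (weber_solutions F m a :: (real ^ 'n ^ 'k) set)"
proof -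
  obtain r where r: "r > 0" "cball 0 r \<subseteq> F"
    using assms(4) by (auto simp: mem_interior_cball)
  show ?thesis
    unfolding compact_eq_bounded_closed
    using bounded_weber_solutions[OF r(2,1) compact_imp_bounded[OF assms(2)] assms(6,8)]
      closed_weber_solutions[OF r(2,1) assms(3)] by blast
qed

end
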